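(* Let $C\in\mathbb{R}^{N\times N}$ be symmetric positive semi-definite and $G\in\mathbb{R}^{N\times N}$ be positive definite (not necessarily symmetric). Let $u:[0,T]\to\mathbb{R}^N$ be continuous and let $x:[0,T]\to\mathbb{R}^N$ be a differentiable solution of $$C\frac{dx}{dt}+Gx=u(t).$$ Write $x(t)=x_{\mathcal R}(t)+x_{\mathcal N}(t)=V_C x_1(t)+V_{\mathcal N}x_2(t)$. Let $B_{1,1}:=V_C^\top G^{-1}CV_C$ and $\widetilde u(t):=B_{1,1}^{-1}V_C^\top G^{-1}u(t)$. Then for all $t\in[0,T]$ $$x_{\mathcal R}(t)=V_Cx_1(t)=V_C\left\{\exp(-tB_{1,1}^{-1})V_C^\top x(0)+\exp(-tB_{1,1}^{-1})\int_0^t\exp(sB_{1,1}^{-1})\,\widetilde u(s)\,ds\right\},$$ and $$x_{\mathcal N}(t)=V_{\mathcal N}x_2(t)=V_{\mathcal N}\,(U_{\mathcal N}^\top G V_{\mathcal N})^{-1}U_{\mathcal N}^\top\bigl(u(t)-GV_Cx_1(t)\bigr).$$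
   Context: A real square matrix $G$ is called positive definite if $v^\top Gv>0$ for every nonzero real vector $v$. Let $n$ be the rank of $C$ and $C=V_CC_1V_C^\top$ its (reduced) eigenvector decomposition: $V_C\in\mathbb{R}^{N\times n}$ has orthonormal columns spanning the range of $C$, and $C_1\in\mathbb{R}^{n\times n}$ is diagonal with positive entries. $P_C=V_CV_C^\top$ is the orthogonal projection onto the range of $C$; $\mathcal R=\{P_Cx:x\in\mathbb{R}^N\}$ and $\mathcal N=\{x\in\mathbb{R}^N:P_Cx=0\}$. The columns of $V_{\mathcal N}\in\mathbb{R}^{N\times(N-n)}$ form a basis of $\mathcal N$; $V=[V_C,V_{\mathcal N}]$, and $U=[U_{\mathcal R},U_{\mathcal N}]:=(V^{-1})^\top$ is partitioned conformably. Thus $x_1(t)\in\mathbb{R}^n$ and $x_2(t)\in\mathbb{R}^{N-n}$ are the coordinates of $x(t)$ in the basis $V$. *)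

theory Defs
  imports
    "HOL-Analysis.Henstock_Kurzweil_Integration"
    "Jordan_Normal_Form.Gauss_Jordan_Elimination"
    "Jordan_Normal_Form.DL_Rank"
begin

text \<open>
  Matrices and vectors are those of Jordan_Normal_Form, whose dimensions are ordinary natural
  numbers and may be zero. This covers a matrix of rank \<open>0\<close> and one of full rank, where one of the
  two blocks is empty.
\<close>

no_notation inner (infix "\<bullet>" 70)

definition pos_def_mat :: "real mat \<Rightarrow> bool" where
  "pos_def_mat A \<longleftrightarrow> square_mat A \<and>
     (\<forall>v \<in> carrier_vec (dim_row A). v \<noteq> 0\<^sub>v (dim_row A) \<longrightarrow> 0 < v \<bullet> (A *\<^sub>v v))"

definition sym_pos_semidef_mat :: "real mat \<Rightarrow> bool" where
  "sym_pos_semidef_mat A \<longleftrightarrow> square_mat A \<and> A\<^sup>T = A \<and>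
     (\<forall>v \<in> carrier_vec (dim_row A). 0 \<le> v \<bullet> (A *\<^sub>v v))"

text \<open>\<open>mat_inverse\<close> is option-valued; the value of \<open>mat_inv A\<close> is unspecified for singular \<open>A\<close>.\<close>

definition mat_inv :: "real mat \<Rightarrow> real mat" where
  "mat_inv A = the (mat_inverse A)"

text \<open>Sum of the exponential series of a square matrix, taken entry by entry.\<close>

definition mat_exp :: "real mat \<Rightarrow> real mat" where
  "mat_exp A = mat (dim_row A) (dim_row A) (\<lambda>(i, j). \<Sum>k. (A ^\<^sub>m k) $$ (i, j) / fact k)"

text \<open>
  The columns of \<open>W\<close>, listed without repetition, form a basis of the subspace \<open>S\<close> of \<open>\<real>\<^sup>m\<close>.
\<close>

definition cols_form_basis :: "nat \<Rightarrow> real mat \<Rightarrow> real vec set \<Rightarrow> bool" where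
  "cols_form_basis m W S \<longleftrightarrow> distinct (cols W) \<and>
     vectorspace.basis class_ring (module_vec TYPE(real) m \<lparr>carrier := S\<rparr>) (set (cols W))"

text \<open>
  The type of vectors carries no topology, so continuity, derivative and integral
  of \<open>\<real>\<^sup>m\<close>-valued functions of a real variable are componentwise.
\<close>

definition vec_continuous_on :: "nat \<Rightarrow> real set \<Rightarrow> (real \<Rightarrow> real vec) \<Rightarrow> bool" where
  "vec_continuous_on m S f \<longleftrightarrow>
     (\<forall>s \<in> S. f s \<in> carrier_vec m) \<and> (\<forall>i < m. continuous_on S (\<lambda>s. f s $ i))"

definition vec_has_deriv :: "nat \<Rightarrow> (real \<Rightarrow> real vec) \<Rightarrow> real vec \<Rightarrow> real filter \<Rightarrow> bool" where
  "vec_has_deriv m f d F \<longleftrightarrow>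
     d \<in> carrier_vec m \<and> (\<forall>i < m. ((\<lambda>s. f s $ i) has_real_derivative d $ i) F)"

definition vec_integral :: "nat \<Rightarrow> real set \<Rightarrow> (real \<Rightarrow> real vec) \<Rightarrow> real vec" where
  "vec_integral m S f = vec m (\<lambda>i. integral S (\<lambda>s. f s $ i))"

end

theory Submission
  imports Defs
begin

text \<open>
  Because \<open>G\<close> is positive definite, it is invertible, and the equation can be multiplied
  by \<open>V\<^sub>C\<^sup>T G\<^sup>-\<^sup>1\<close>. Since \<open>V\<^sub>C\<^sup>T V\<^sub>C = 1\<close> and \<open>V\<^sub>C\<^sup>T\<close> annihilates the null
  space \<open>NN\<close>, the first coordinate is \<open>x\<^sub>1 = V\<^sub>C\<^sup>T x\<close>; it inherits differentiability from \<open>x\<close>.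
  Moreover \<open>C = C V\<^sub>C V\<^sub>C\<^sup>T\<close>, so the multiplied equation closes up in \<open>x\<^sub>1\<close> alone:
  \<open>B\<^sub>1\<^sub>1 x\<^sub>1' + x\<^sub>1 = V\<^sub>C\<^sup>T G\<^sup>-\<^sup>1 u\<close>. Once \<open>B\<^sub>1\<^sub>1\<close> is known to be invertible this is the linear
  system \<open>x\<^sub>1' + B\<^sub>1\<^sub>1\<^sup>-\<^sup>1 x\<^sub>1 = u\<^sub>t\<close>, which \<open>variation_of_constants\<close> solves. That lemma
  rests on two facts about the exponential: its entries are everywhere convergent power series
  in the time parameter, so they are differentiated term by term
  (\<open>mat_exp_entry_has_derivative\<close>), and \<open>exp (- t A)\<close> inverts \<open>exp (t A)\<close>
  (\<open>mat_exp_minus_mult_vec\<close>).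

  The second coordinate is determined algebraically. The duality \<open>U\<^sup>T V = 1\<close> splits into blocks
  (\<open>dual_basis_blocks\<close>), among them \<open>U\<^sub>N\<^sup>T V\<^sub>C = 0\<close>. Hence multiplication by \<open>U\<^sub>N\<^sup>T\<close> removes
  \<open>C x'\<close> and leaves \<open>(U\<^sub>N\<^sup>T G V\<^sub>N) x\<^sub>2 = U\<^sub>N\<^sup>T (u - G V\<^sub>C x\<^sub>1)\<close>.

  The invertibility claims are all obtained from a trivial kernel
  (\<open>inverse_of_trivial_kernel\<close>). For \<open>B\<^sub>1\<^sub>1\<close> and \<open>U\<^sub>N\<^sup>T G V\<^sub>N\<close>, a kernel vector is turned into a
  vector \<open>w\<close> with \<open>w \<bullet> G w = 0\<close>, which positive definiteness forces to vanish.
\<close>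

text \<open>Leaves \<open>$\<close> to the component access of \<open>'a vec\<close>, which it would share with \<open>'a ^ 'n\<close>.\<close>

unbundle no vec_syntax

section \<open>Entries and elementary vector algebra\<close>

lemma index_mult_mat_sum:
  assumes "A \<in> carrier_mat n m" "B \<in> carrier_mat m k" "i < n" "j < k"
  shows "(A * B) $$ (i, j) = (\<Sum>l<m. A $$ (i, l) * B $$ (l, j))"
  using assms by (auto simp: scalar_prod_def lessThan_atLeast0 intro!: sum.cong)

lemma index_mult_mat_vec_sum:
  assumes "A \<in> carrier_mat n m" "v \<in> carrier_vec m" "i < n"
  shows "(A *\<^sub>v v) $ i = (\<Sum>l<m. A $$ (i, l) * v $ l)"
  using assms by (auto simp: scalar_prod_def lessThan_atLeast0 intro!: sum.cong)

lemma mult_mat_zero_vec: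
  assumes "A \<in> carrier_mat n m"
  shows "A *\<^sub>v 0\<^sub>v m = 0\<^sub>v n"
  using assms by (intro eq_vecI) (auto simp: scalar_prod_def)

lemma zero_mult_mat_vec:
  assumes "v \<in> carrier_vec m"
  shows "0\<^sub>m n m *\<^sub>v v = 0\<^sub>v n"
  using assms by (intro eq_vecI) (auto simp: scalar_prod_def)

lemma add_diff_cancel_right_vec:
  fixes a b :: "'a::ab_group_add vec"
  assumes "a \<in> carrier_vec n" "b \<in> carrier_vec n"
  shows "a + b - b = a"
  using assms by (intro eq_vecI) auto

section \<open>Inverses from trivial kernels\<close>

lemma inverse_of_trivial_kernel:
  assumes A: "A \<in> carrier_mat k k"
    and ker: "\<And>v. v \<in> carrier_vec k \<Longrightarrow> A *\<^sub>v v = 0\<^sub>v k \<Longrightarrow> v = 0\<^sub>v k"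
  shows "invertible_mat A" "mat_inv A \<in> carrier_mat k k"
    "A * mat_inv A = 1\<^sub>m k" "mat_inv A * A = 1\<^sub>m k"
proof -
  have "det A \<noteq> 0"
    using det_0_iff_vec_prod_zero_field[OF A] ker by blast
  then have "A \<in> Units (ring_mat TYPE(real) k ())"
    by (rule det_non_zero_imp_unit[OF A])
  then obtain B where "mat_inverse A = Some B"
    using mat_inverse(1)[OF A] by fastforce
  then have inv: "A * mat_inv A = 1\<^sub>m k \<and> mat_inv A * A = 1\<^sub>m k \<and> mat_inv A \<in> carrier_mat k k"
    using mat_inverse(2)[OF A] by (simp add: mat_inv_def)
  then show "mat_inv A \<in> carrier_mat k k" "A * mat_inv A = 1\<^sub>m k" "mat_inv A * A = 1\<^sub>m k"
    by auto
  then show "invertible_mat A"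
    using A unfolding invertible_mat_def inverts_mat_def by auto
qed

text \<open>
  Independence is stated inside the module with carrier \<open>S\<close>. It is the same as independence in
  the whole space because \<open>S\<close> is a submodule, and there it says that \<open>W\<close> has trivial kernel.
\<close>

lemma cols_form_basis_trivial_kernel:
  assumes W: "W \<in> carrier_mat N k" and basis: "cols_form_basis N W S"
    and S: "submodule class_ring S (module_vec TYPE(real) N)"
    and v: "v \<in> carrier_vec k" "W *\<^sub>v v = 0\<^sub>v N"
  shows "v = 0\<^sub>v k" "set (cols W) \<subseteq> S"
proof -
  interpret vec_space "TYPE(real)" N .
  let ?S = "module_vec TYPE(real) N\<lparr>carrier := S\<rparr>"
  have vs: "vectorspace class_ring ?S"
    using subspace.intro[of class_ring V S] S vectorspace_axioms
    by (intro subspace_is_vs) auto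
  have d: "distinct (cols W)" and b: "vectorspace.basis class_ring ?S (set (cols W))"
    using basis by (auto simp: cols_form_basis_def)
  show sub: "set (cols W) \<subseteq> S"
    using b unfolding vectorspace.basis_def[OF vs] by simp
  have "LinearCombinations.module.lin_indpt class_ring ?S (set (cols W))"
    using b unfolding vectorspace.basis_def[OF vs] by simp
  then have "lin_indpt (set (cols W))"
    using span_li_not_depend(2)[OF sub S] by simp
  then show "v = 0\<^sub>v k"
    using lin_depI[OF W v(1) _ v(2) d] by blast
qed

lemma pos_def_mat_trivial_kernel:
  assumes "pos_def_mat G" "G \<in> carrier_mat N N" "v \<in> carrier_vec N" "v \<bullet> (G *\<^sub>v v) = 0"
  shows "v = 0\<^sub>v N"
  using assms unfolding pos_def_mat_def by force

lemma pos_diagonal_mat_trivial_kernel: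
  fixes D :: "real mat"
  assumes D: "D \<in> carrier_mat n n" "diagonal_mat D" "\<forall>i<n. 0 < D $$ (i, i)"
    and v: "v \<in> carrier_vec n" "D *\<^sub>v v = 0\<^sub>v n"
  shows "v = 0\<^sub>v n"
proof (rule eq_vecI)
  fix i assume "i < dim_vec (0\<^sub>v n)"
  then have i: "i < n" by simp
  have "(D *\<^sub>v v) $ i = (\<Sum>l<n. if l = i then D $$ (i, i) * v $ i else 0)"
    unfolding index_mult_mat_vec_sum[OF D(1) v(1) i]
    using D i by (intro sum.cong) (auto simp: diagonal_mat_def)
  then have "D $$ (i, i) * v $ i = 0" using v i by simp
  then show "v $ i = 0\<^sub>v n $ i" using D i by auto
qed (use v in auto)

lemma submodule_null_space:
  fixes P :: "real mat"
  assumes P: "P \<in> carrier_mat N N"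
  shows "submodule class_ring {z \<in> carrier_vec N. P *\<^sub>v z = 0\<^sub>v N} (module_vec TYPE(real) N)"
proof -
  interpret vec_space "TYPE(real)" N .
  show ?thesis
    using P module_axioms
    by unfold_locales
      (auto simp: mult_add_distrib_mat_vec[of _ N N] mult_mat_vec[of _ N N] mult_mat_zero_vec)
qed

section \<open>The exponential of a matrix\<close>

lemma pow_mat_Suc_left:
  assumes A: "A \<in> carrier_mat n n"
  shows "A ^\<^sub>m Suc k = A * A ^\<^sub>m k"
proof (induction k)
  case (Suc k)
  have "A ^\<^sub>m Suc (Suc k) = (A * A ^\<^sub>m k) * A"
    using Suc by simp
  also have "\<dots> = A * A ^\<^sub>m Suc k"
    using A by (simp add: assoc_mult_mat[of _ n n _ n _ n])
  finally show ?case .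
qed (use A in simp)

text \<open>
  Pulls the time parameter out of the powers, so that the entries of \<open>mat_exp (t \<cdot>\<^sub>m A)\<close> are
  power series in \<open>t\<close> with coefficients independent of \<open>t\<close>.
\<close>

lemma pow_mat_smult:
  assumes A: "(A :: 'a::comm_ring_1 mat) \<in> carrier_mat n n"
  shows "(t \<cdot>\<^sub>m A) ^\<^sub>m k = t ^ k \<cdot>\<^sub>m A ^\<^sub>m k"
proof (induction k)
  case (Suc k)
  have "(t \<cdot>\<^sub>m A) ^\<^sub>m Suc k = (t ^ k \<cdot>\<^sub>m A ^\<^sub>m k) * (t \<cdot>\<^sub>m A)"
    using Suc by simp
  also have "\<dots> = t ^ Suc k \<cdot>\<^sub>m A ^\<^sub>m Suc k"
    using A by (intro eq_matI) (auto simp: algebra_simps)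
  finally show ?case .
qed (use A in \<open>auto intro!: eq_matI\<close>)

text \<open>
  The sum of the absolute values of all entries is submultiplicative and bounds every entry;
  this geometric bound makes the entrywise exponential series converge.
\<close>

lemma abs_pow_mat_le:
  fixes A :: "real mat"
  assumes A: "A \<in> carrier_mat n n" and "i < n" "j < n"
  shows "\<bar>(A ^\<^sub>m k) $$ (i, j)\<bar> \<le> (\<Sum>l<n. \<Sum>m<n. \<bar>A $$ (l, m)\<bar>) ^ k"
  using assms(3)
proof (induction k arbitrary: j)
  case 0
  then show ?case using A \<open>i < n\<close> by simp
next
  case (Suc k)
  let ?c = "\<Sum>l<n. \<Sum>m<n. \<bar>A $$ (l, m)\<bar>"
  have c: "0 \<le> ?c" by (simp add: sum_nonneg)
  have "\<bar>(A ^\<^sub>m Suc k) $$ (i, j)\<bar> = \<bar>\<Sum>l<n. (A ^\<^sub>m k) $$ (i, l) * A $$ (l, j)\<bar>"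
    using A \<open>i < n\<close> \<open>j < n\<close> by (simp add: index_mult_mat_sum[of _ n n _ n] del: index_mult_mat)
  also have "\<dots> \<le> (\<Sum>l<n. \<bar>(A ^\<^sub>m k) $$ (i, l)\<bar> * \<bar>A $$ (l, j)\<bar>)"
    by (rule order_trans[OF sum_abs]) (simp add: abs_mult)
  also have "\<dots> \<le> (\<Sum>l<n. ?c ^ k * (\<Sum>m<n. \<bar>A $$ (l, m)\<bar>))"
  proof (intro sum_mono mult_mono)
    fix l assume l: "l \<in> {..<n}"
    show "\<bar>A $$ (l, j)\<bar> \<le> (\<Sum>m<n. \<bar>A $$ (l, m)\<bar>)"
      using \<open>j < n\<close> by (intro member_le_sum) auto
  qed (use Suc.IH c in auto)
  also have "\<dots> = ?c ^ Suc k"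
    by (simp only: sum_distrib_left[symmetric] power_Suc2)
  finally show ?case .
qed

lemma summable_mat_exp_entry:
  fixes A :: "real mat"
  assumes A: "A \<in> carrier_mat n n" "i < n" "j < n"
  shows "summable (\<lambda>k. (A ^\<^sub>m k) $$ (i, j) / fact k * t ^ k)"
proof (rule summable_comparison_test')
  let ?c = "\<Sum>l<n. \<Sum>m<n. \<bar>A $$ (l, m)\<bar>"
  show "summable (\<lambda>k. inverse (fact k) * (?c * \<bar>t\<bar>) ^ k)"
    by (rule summable_exp)
  fix k :: nat
  have "\<bar>(A ^\<^sub>m k) $$ (i, j)\<bar> * \<bar>t\<bar> ^ k / fact k \<le> ?c ^ k * \<bar>t\<bar> ^ k / fact k"
    by (intro divide_right_mono mult_right_mono abs_pow_mat_le assms) auto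
  then show "norm ((A ^\<^sub>m k) $$ (i, j) / fact k * t ^ k) \<le> inverse (fact k) * (?c * \<bar>t\<bar>) ^ k"
    by (simp add: abs_mult power_abs power_mult_distrib field_simps)
qed

lemma dim_mat_exp [simp]: "dim_row (mat_exp A) = dim_row A" "dim_col (mat_exp A) = dim_row A"
  by (simp_all add: mat_exp_def)

lemma mat_exp_carrier [simp]: "A \<in> carrier_mat n n \<Longrightarrow> mat_exp A \<in> carrier_mat n n"
  by (simp add: mat_exp_def)

lemma mat_exp_smult_entry:
  assumes A: "A \<in> carrier_mat n n" "i < n" "j < n"
  shows "mat_exp (t \<cdot>\<^sub>m A) $$ (i, j) = (\<Sum>k. (A ^\<^sub>m k) $$ (i, j) / fact k * t ^ k)"
  using A by (simp add: mat_exp_def pow_mat_smult mult.commute)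

lemma mat_exp_zero:
  assumes A: "A \<in> carrier_mat n n"
  shows "mat_exp (0 \<cdot>\<^sub>m A) = 1\<^sub>m n"
proof (rule eq_matI)
  fix i j assume "i < dim_row (1\<^sub>m n)" "j < dim_col (1\<^sub>m n)"
  then have ij: "i < n" "j < n" by auto
  show "mat_exp (0 \<cdot>\<^sub>m A) $$ (i, j) = 1\<^sub>m n $$ (i, j)"
    using A ij unfolding mat_exp_smult_entry[OF A ij] powser_zero by simp
qed (use A in \<open>auto simp: mat_exp_def\<close>)

text \<open>
  Both products have the same series because a power of \<open>A\<close> can be extended by a factor on
  either side. The common series is also the termwise derivative of the exponential.
\<close>

lemma mat_exp_mult_entry:
  assumes A: "A \<in> carrier_mat n n" and ij: "i < n" "j < n"
  shows "(mat_exp (t \<cdot>\<^sub>m A) * A) $$ (i, j) = (\<Sum>k. (A ^\<^sub>m Suc k) $$ (i, j) / fact k * t ^ k)"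
    "(A * mat_exp (t \<cdot>\<^sub>m A)) $$ (i, j) = (\<Sum>k. (A ^\<^sub>m Suc k) $$ (i, j) / fact k * t ^ k)"
proof -
  have E: "mat_exp (t \<cdot>\<^sub>m A) \<in> carrier_mat n n" using A by simp
  have "(mat_exp (t \<cdot>\<^sub>m A) * A) $$ (i, j)
      = (\<Sum>l<n. (\<Sum>k. (A ^\<^sub>m k) $$ (i, l) / fact k * t ^ k) * A $$ (l, j))"
    using A ij by (simp add: index_mult_mat_sum[OF E A] mat_exp_smult_entry del: index_mult_mat(1))
  also have "\<dots> = (\<Sum>l<n. \<Sum>k. (A ^\<^sub>m k) $$ (i, l) / fact k * t ^ k * A $$ (l, j))"
    using A ij by (intro sum.cong refl suminf_mult2 summable_mat_exp_entry) auto
  also have "\<dots> = (\<Sum>k. \<Sum>l<n. (A ^\<^sub>m k) $$ (i, l) / fact k * t ^ k * A $$ (l, j))"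
    using A ij by (intro suminf_sum[symmetric] summable_mult2 summable_mat_exp_entry) auto
  also have "\<dots> = (\<Sum>k. (A ^\<^sub>m Suc k) $$ (i, j) / fact k * t ^ k)"
    using A ij by (intro suminf_cong)
      (simp add: index_mult_mat_sum[of _ n n _ n] sum_distrib_left sum_distrib_right
        sum_divide_distrib algebra_simps del: index_mult_mat)
  finally show "(mat_exp (t \<cdot>\<^sub>m A) * A) $$ (i, j) = (\<Sum>k. (A ^\<^sub>m Suc k) $$ (i, j) / fact k * t ^ k)" .
  have "(A * mat_exp (t \<cdot>\<^sub>m A)) $$ (i, j)
      = (\<Sum>l<n. A $$ (i, l) * (\<Sum>k. (A ^\<^sub>m k) $$ (l, j) / fact k * t ^ k))"
    using A ij by (simp add: index_mult_mat_sum[OF A E] mat_exp_smult_entry del: index_mult_mat(1))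
  also have "\<dots> = (\<Sum>l<n. \<Sum>k. A $$ (i, l) * ((A ^\<^sub>m k) $$ (l, j) / fact k * t ^ k))"
    using A ij by (intro sum.cong refl suminf_mult[symmetric] summable_mat_exp_entry) auto
  also have "\<dots> = (\<Sum>k. \<Sum>l<n. A $$ (i, l) * ((A ^\<^sub>m k) $$ (l, j) / fact k * t ^ k))"
    using A ij by (intro suminf_sum[symmetric] summable_mult summable_mat_exp_entry) auto
  also have "\<dots> = (\<Sum>k. (A ^\<^sub>m Suc k) $$ (i, j) / fact k * t ^ k)"
    using A ij by (intro suminf_cong)
      (simp add: pow_mat_Suc_left index_mult_mat_sum[of _ n n _ n] sum_distrib_left sum_distrib_right
        sum_divide_distrib algebra_simps del: index_mult_mat pow_mat.simps)
  finally show "(A * mat_exp (t \<cdot>\<^sub>m A)) $$ (i, j) = (\<Sum>k. (A ^\<^sub>m Suc k) $$ (i, j) / fact k * t ^ k)" .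
qed

lemma mat_exp_commute:
  assumes A: "A \<in> carrier_mat n n"
  shows "mat_exp (t \<cdot>\<^sub>m A) * A = A * mat_exp (t \<cdot>\<^sub>m A)"
  using A mat_exp_carrier[of "t \<cdot>\<^sub>m A" n]
  by (intro eq_matI) (simp_all add: mat_exp_mult_entry[OF A] del: index_mult_mat(1) pow_mat.simps)

lemma mat_exp_entry_has_derivative:
  assumes A: "A \<in> carrier_mat n n" and ij: "i < n" "j < n"
  shows "((\<lambda>s. mat_exp (s \<cdot>\<^sub>m A) $$ (i, j)) has_real_derivative
    (mat_exp (t \<cdot>\<^sub>m A) * A) $$ (i, j)) (at t)"
proof -
  have *: "diffs (\<lambda>k. (A ^\<^sub>m k) $$ (i, j) / fact k) = (\<lambda>k. (A ^\<^sub>m Suc k) $$ (i, j) / fact k)"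
    by (simp only: diffs_def fun_eq_iff fact_Suc of_nat_mult times_divide_eq_right
        mult_divide_mult_cancel_left_if) simp
  show ?thesis
    using termdiffs_strong_converges_everywhere[OF summable_mat_exp_entry[OF A ij], of t]
    by (simp add: * mat_exp_smult_entry[OF A ij] mat_exp_mult_entry[OF A ij]
        del: index_mult_mat(1) pow_mat.simps)
qed

lemma mult_mat_vec_has_deriv:
  assumes M: "\<And>s. s \<in> S \<Longrightarrow> M s \<in> carrier_mat n m" "M' \<in> carrier_mat n m"
    and M': "\<And>i j. i < n \<Longrightarrow> j < m \<Longrightarrow>
      ((\<lambda>s. M s $$ (i, j)) has_real_derivative M' $$ (i, j)) (at t within S)"
    and v: "\<And>s. s \<in> S \<Longrightarrow> v s \<in> carrier_vec m"
    and v': "vec_has_deriv m v v' (at t within S)" and t: "t \<in> S"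
  shows "vec_has_deriv n (\<lambda>s. M s *\<^sub>v v s) (M' *\<^sub>v v t + M t *\<^sub>v v') (at t within S)"
  unfolding vec_has_deriv_def
proof (intro conjI allI impI)
  have vc: "v' \<in> carrier_vec m" and
    vd: "\<And>j. j < m \<Longrightarrow> ((\<lambda>s. v s $ j) has_real_derivative v' $ j) (at t within S)"
    using v' by (auto simp: vec_has_deriv_def)
  show "M' *\<^sub>v v t + M t *\<^sub>v v' \<in> carrier_vec n"
    using M t v vc by (meson add_carrier_vec mult_mat_vec_carrier)
  fix i assume i: "i < n"
  have "((\<lambda>s. \<Sum>j<m. M s $$ (i, j) * v s $ j) has_real_derivative
      (\<Sum>j<m. M' $$ (i, j) * v t $ j + v' $ j * M t $$ (i, j))) (at t within S)"
    by (intro DERIV_sum DERIV_mult M' vd) (use i in auto)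
  also have "(\<Sum>j<m. M' $$ (i, j) * v t $ j + v' $ j * M t $$ (i, j))
      = (M' *\<^sub>v v t + M t *\<^sub>v v') $ i"
    using i M(1)[OF t] M(2) v[OF t] vc
    by (simp add: index_mult_mat_vec_sum[of _ n m] sum.distrib mult.commute
        del: index_mult_mat_vec)
  finally show "((\<lambda>s. (M s *\<^sub>v v s) $ i) has_real_derivative (M' *\<^sub>v v t + M t *\<^sub>v v') $ i) (at t within S)"
    by (rule has_field_derivative_transform_within[where d = 1])
      (use t i M v in \<open>auto simp: index_mult_mat_vec_sum[of _ n m] simp del: index_mult_mat_vec\<close>)
qed

text \<open>
  The left-hand side, as a function of \<open>t\<close>, has derivative
  \<open>- exp (- t A) A exp (t A) z + exp (- t A) A exp (t A) z = 0\<close>, and at \<open>t = 0\<close> it equals \<open>z\<close>.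
  This avoids multiplying the two exponential series.
\<close>

lemma mat_exp_minus_mult_vec:
  assumes A: "A \<in> carrier_mat n n" and z: "z \<in> carrier_vec n"
  shows "mat_exp ((- t) \<cdot>\<^sub>m A) *\<^sub>v (mat_exp (t \<cdot>\<^sub>m A) *\<^sub>v z) = z"
proof (rule eq_vecI)
  let ?E = "\<lambda>t. mat_exp (t \<cdot>\<^sub>m A)"
  have E: "?E s \<in> carrier_mat n n" for s using A by simp
  define w where "w s = ?E (- s) *\<^sub>v (?E s *\<^sub>v z)" for s
  have inner: "vec_has_deriv n (\<lambda>s. ?E s *\<^sub>v z) ((?E r * A) *\<^sub>v z + ?E r *\<^sub>v 0\<^sub>v n) (at r)" for r
  proof (rule mult_mat_vec_has_deriv)
    show "?E r * A \<in> carrier_mat n n"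
      using E A by (rule mult_carrier_mat)
  qed (use E z mat_exp_entry_has_derivative[OF A] in \<open>auto simp: vec_has_deriv_def\<close>)
  have neg: "((\<lambda>s. ?E (- s) $$ (i, j)) has_real_derivative (- (?E (- r) * A)) $$ (i, j)) (at r)"
    if "i < n" "j < n" for i j r
    using DERIV_chain2[OF mat_exp_entry_has_derivative[OF A that, of "- r"]
        DERIV_minus[OF DERIV_ident]] A that
    by simp
  have "vec_has_deriv n w (- (?E (- r) * A) *\<^sub>v (?E r *\<^sub>v z)
      + ?E (- r) *\<^sub>v ((?E r * A) *\<^sub>v z + ?E r *\<^sub>v 0\<^sub>v n)) (at r)" for r
    unfolding w_def
  proof (rule mult_mat_vec_has_deriv)
    show "- (?E (- r) * A) \<in> carrier_mat n n"
      using mult_carrier_mat[OF E A] by simp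
    show "?E s *\<^sub>v z \<in> carrier_vec n" for s
      using E z by (rule mult_mat_vec_carrier)
  qed (use E neg inner in auto)
  moreover have "- (?E (- r) * A) *\<^sub>v (?E r *\<^sub>v z)
      + ?E (- r) *\<^sub>v ((?E r * A) *\<^sub>v z + ?E r *\<^sub>v 0\<^sub>v n) = 0\<^sub>v n" for r
  proof -
    have "(?E r * A) *\<^sub>v z + ?E r *\<^sub>v 0\<^sub>v n = A *\<^sub>v (?E r *\<^sub>v z)"
    proof -
      have "?E r *\<^sub>v 0\<^sub>v n = 0\<^sub>v n"
        using E by (rule mult_mat_zero_vec)
      moreover have "A *\<^sub>v (?E r *\<^sub>v z) \<in> carrier_vec n"
        using A E z by (meson mult_mat_vec_carrier)
      ultimately show ?thesis
        using A z by (simp add: mat_exp_commute assoc_mult_mat_vec[of _ n n _ n] right_zero_vec)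
    qed
    moreover have "- (?E (- r) * A) *\<^sub>v (?E r *\<^sub>v z) = - (?E (- r) *\<^sub>v (A *\<^sub>v (?E r *\<^sub>v z)))"
      using A E[of r] z assoc_mult_mat_vec[OF E[of "- r"] A mult_mat_vec_carrier[OF E[of r] z]]
      by simp
    moreover have "?E (- r) *\<^sub>v (A *\<^sub>v (?E r *\<^sub>v z)) \<in> carrier_vec n"
      using E A z by (meson mult_mat_vec_carrier)
    ultimately show ?thesis
      by (simp add: uminus_l_inv_vec)
  qed
  ultimately have "vec_has_deriv n w (0\<^sub>v n) (at r)" for r by simp
  then have "w t $ i = w 0 $ i" if "i < n" for i
    using that by (intro DERIV_isconst_all) (simp add: vec_has_deriv_def)
  moreover have "w 0 = z"
    using z by (simp add: w_def mat_exp_zero[OF A])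
  ultimately show "i < dim_vec z \<Longrightarrow> (?E (- t) *\<^sub>v (?E t *\<^sub>v z)) $ i = z $ i" for i
    using z unfolding w_def by auto
  show "dim_vec (?E (- t) *\<^sub>v (?E t *\<^sub>v z)) = dim_vec z"
    using E[of "-t"] z by auto
qed

text \<open>
  The integrating factor \<open>exp (s A)\<close> turns the equation \<open>y' = f - A y\<close> into
  \<open>(exp (s A) y)' = exp (s A) f\<close>. The fundamental theorem of calculus integrates this derivative,
  which also supplies the integrability of the right-hand side.
\<close>

lemma variation_of_constants:
  assumes A: "A \<in> carrier_mat n n"
    and y: "\<And>s. s \<in> {0..T} \<Longrightarrow> y s \<in> carrier_vec n"
    and f: "\<And>s. s \<in> {0..T} \<Longrightarrow> f s \<in> carrier_vec n"
    and y': "\<And>s. s \<in> {0..T} \<Longrightarrow> vec_has_deriv n y (f s - A *\<^sub>v y s) (at s within {0..T})"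
    and t: "t \<in> {0..T}"
  shows "y t = mat_exp ((- t) \<cdot>\<^sub>m A) *\<^sub>v y 0 +
    mat_exp ((- t) \<cdot>\<^sub>m A) *\<^sub>v vec_integral n {0..t} (\<lambda>s. mat_exp (s \<cdot>\<^sub>m A) *\<^sub>v f s)"
proof -
  let ?E = "\<lambda>t. mat_exp (t \<cdot>\<^sub>m A)"
  let ?I = "vec_integral n {0..t} (\<lambda>s. ?E s *\<^sub>v f s)"
  have E: "?E s \<in> carrier_mat n n" for s using A by simp
  \<comment> \<open>The two terms with \<open>A\<close> that the product rule produces cancel.\<close>
  have deriv: "vec_has_deriv n (\<lambda>s. ?E s *\<^sub>v y s) (?E s *\<^sub>v f s) (at s within {0..T})"
    if s: "s \<in> {0..T}" for s
  proof -
    have "vec_has_deriv n (\<lambda>s. ?E s *\<^sub>v y s)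
        ((?E s * A) *\<^sub>v y s + ?E s *\<^sub>v (f s - A *\<^sub>v y s)) (at s within {0..T})"
    proof (rule mult_mat_vec_has_deriv)
      show "?E s * A \<in> carrier_mat n n"
        using E A by (rule mult_carrier_mat)
    qed (use E y s y'[OF s] has_field_derivative_at_within[OF mat_exp_entry_has_derivative[OF A]] in auto)
    moreover have "(?E s * A) *\<^sub>v y s + ?E s *\<^sub>v (f s - A *\<^sub>v y s) = ?E s *\<^sub>v f s"
    proof -
      have "?E s *\<^sub>v (f s - A *\<^sub>v y s) = ?E s *\<^sub>v f s - (?E s * A) *\<^sub>v y s"
        using A E[of s] y[OF s] f[OF s]
        by (simp add: mult_minus_distrib_mat_vec[of _ n n] assoc_mult_mat_vec[of _ n n _ n])
      moreover have "?E s *\<^sub>v f s \<in> carrier_vec n" "(?E s * A) *\<^sub>v y s \<in> carrier_vec n"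
        using mult_mat_vec_carrier[OF E f[OF s]]
          mult_mat_vec_carrier[OF mult_carrier_mat[OF E A] y[OF s]] by blast+
      ultimately show ?thesis
        by (intro eq_vecI) auto
    qed
    ultimately show ?thesis by simp
  qed
  have I: "?I \<in> carrier_vec n" by (simp add: vec_integral_def)
  have y0: "y 0 \<in> carrier_vec n" and yt: "y t \<in> carrier_vec n" using t y by auto
  have "?E t *\<^sub>v y t = y 0 + ?I"
  proof (rule eq_vecI)
    fix i assume "i < dim_vec (y 0 + ?I)"
    then have i: "i < n" using I by simp
    have "((\<lambda>s. (?E s *\<^sub>v f s) $ i) has_integral (?E t *\<^sub>v y t) $ i - (?E 0 *\<^sub>v y 0) $ i) {0..t}"
    proof (rule fundamental_theorem_of_calculus)
      show "0 \<le> t" using t by simp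
      fix s assume "s \<in> {0..t}"
      then have "s \<in> {0..T}" using t by simp
      then have "((\<lambda>s. (?E s *\<^sub>v y s) $ i) has_real_derivative (?E s *\<^sub>v f s) $ i) (at s within {0..T})"
        using deriv i unfolding vec_has_deriv_def by blast
      then have "((\<lambda>s. (?E s *\<^sub>v y s) $ i) has_real_derivative (?E s *\<^sub>v f s) $ i) (at s within {0..t})"
        by (rule has_field_derivative_subset) (use t in auto)
      then show "((\<lambda>s. (?E s *\<^sub>v y s) $ i) has_vector_derivative (?E s *\<^sub>v f s) $ i) (at s within {0..t})"
        by (simp add: has_real_derivative_iff_has_vector_derivative)
    qed
    then have "integral {0..t} (\<lambda>s. (?E s *\<^sub>v f s) $ i) = (?E t *\<^sub>v y t) $ i - y 0 $ i"
      using y0 by (simp add: integral_unique mat_exp_zero[OF A])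
    then show "(?E t *\<^sub>v y t) $ i = (y 0 + ?I) $ i"
      using i y0 I by (simp add: vec_integral_def)
  qed (use E[of t] I in auto)
  then have "y t = ?E (- t) *\<^sub>v (y 0 + ?I)"
    using mat_exp_minus_mult_vec[OF A yt, of t] by simp
  then show ?thesis
    using mult_add_distrib_mat_vec[OF E y0 I] by simp
qed

section \<open>Blocks of a basis and of its dual basis\<close>

text \<open>
  Blocks with zero rows turn juxtaposition of columns into a special case of block matrices,
  so that products can be computed blockwise.
\<close>

lemma mat_of_cols_append_eq_four_block:
  assumes "A \<in> carrier_mat N n" "B \<in> carrier_mat N k"
  shows "mat_of_cols N (cols A @ cols B) = four_block_mat A B (0\<^sub>m 0 n) (0\<^sub>m 0 k)"
  using assms by (intro eq_matI) (auto simp: mat_of_cols_index nth_append)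

lemma mat_of_cols_append_mult_append_vec:
  assumes A: "A \<in> carrier_mat N n" "B \<in> carrier_mat N k"
    and a: "a \<in> carrier_vec n" "b \<in> carrier_vec k"
  shows "mat_of_cols N (cols A @ cols B) *\<^sub>v (a @\<^sub>v b) = A *\<^sub>v a + B *\<^sub>v b"
  unfolding mat_of_cols_append_eq_four_block[OF A]
proof (rule eq_vecI)
  fix i assume "i < dim_vec (A *\<^sub>v a + B *\<^sub>v b)"
  then have i: "i < N" using A by simp
  have "row (four_block_mat A B (0\<^sub>m 0 n) (0\<^sub>m 0 k)) i = row A i @\<^sub>v row B i"
    by (rule row_four_block_mat(1)[OF A _ _ i]) auto
  then show "(four_block_mat A B (0\<^sub>m 0 n) (0\<^sub>m 0 k) *\<^sub>v (a @\<^sub>v b)) $ i = (A *\<^sub>v a + B *\<^sub>v b) $ i"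
    using A a i by (simp add: scalar_prod_append[of _ n _ k])
qed (use A in auto)

text \<open>
  The first two identities are the lower blocks of \<open>W\<^sup>T V = 1\<close>; the third is \<open>W V\<^sup>T = 1\<close>, which
  expands every vector in the basis formed by the columns of \<open>W = [P, Q]\<close> by pairing it with
  the columns of \<open>V = [A, B]\<close>.
\<close>

lemma dual_basis_blocks:
  fixes A B P Q :: "'a::comm_ring_1 mat"
  assumes A: "A \<in> carrier_mat N n" "B \<in> carrier_mat N k"
    and P: "P \<in> carrier_mat N n" "Q \<in> carrier_mat N k"
    and WV: "(mat_of_cols N (cols P @ cols Q))\<^sup>T * mat_of_cols N (cols A @ cols B) = 1\<^sub>m (n + k)"
    and VW: "mat_of_cols N (cols P @ cols Q) * (mat_of_cols N (cols A @ cols B))\<^sup>T = 1\<^sub>m N"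
  shows "Q\<^sup>T * A = 0\<^sub>m k n" "Q\<^sup>T * B = 1\<^sub>m k" "P * A\<^sup>T + Q * B\<^sup>T = 1\<^sub>m N"
proof -
  let ?Z = "\<lambda>m. 0\<^sub>m 0 m :: 'a mat"
  have T: "(four_block_mat X Y (?Z n) (?Z k))\<^sup>T
      = four_block_mat X\<^sup>T (0\<^sub>m n 0) Y\<^sup>T (0\<^sub>m k 0)"
    if "X \<in> carrier_mat N n" "Y \<in> carrier_mat N k" for X Y
    using transpose_four_block_mat[OF that, of "?Z n" 0 "?Z k"] by simp
  have "four_block_mat P\<^sup>T (0\<^sub>m n 0) Q\<^sup>T (0\<^sub>m k 0) * four_block_mat A B (?Z n) (?Z k)
      = four_block_mat (P\<^sup>T * A + 0\<^sub>m n 0 * ?Z n) (P\<^sup>T * B + 0\<^sub>m n 0 * ?Z k)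
          (Q\<^sup>T * A + 0\<^sub>m k 0 * ?Z n) (Q\<^sup>T * B + 0\<^sub>m k 0 * ?Z k)"
    using A P by (intro mult_four_block_mat) auto
  then have WV': "four_block_mat (P\<^sup>T * A + 0\<^sub>m n 0 * ?Z n) (P\<^sup>T * B + 0\<^sub>m n 0 * ?Z k)
          (Q\<^sup>T * A + 0\<^sub>m k 0 * ?Z n) (Q\<^sup>T * B + 0\<^sub>m k 0 * ?Z k) = 1\<^sub>m (n + k)"
    using WV unfolding mat_of_cols_append_eq_four_block[OF A] mat_of_cols_append_eq_four_block[OF P] T[OF P]
    by simp
  show "Q\<^sup>T * A = 0\<^sub>m k n"
  proof (rule eq_matI)
    fix i j assume "i < dim_row (0\<^sub>m k n)" "j < dim_col (0\<^sub>m k n)"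
    then show "(Q\<^sup>T * A) $$ (i, j) = 0\<^sub>m k n $$ (i, j)"
      using arg_cong[OF WV', of "\<lambda>M. M $$ (n + i, j)"] A P by (simp add: scalar_prod_def)
  qed (use A P in auto)
  show "Q\<^sup>T * B = 1\<^sub>m k"
  proof (rule eq_matI)
    fix i j assume "i < dim_row (1\<^sub>m k)" "j < dim_col (1\<^sub>m k)"
    then show "(Q\<^sup>T * B) $$ (i, j) = 1\<^sub>m k $$ (i, j)"
      using arg_cong[OF WV', of "\<lambda>M. M $$ (n + i, n + j)"] A P by (simp add: scalar_prod_def)
  qed (use A P in auto)
  have "four_block_mat P Q (?Z n) (?Z k) * four_block_mat A\<^sup>T (0\<^sub>m n 0) B\<^sup>T (0\<^sub>m k 0)
      = four_block_mat (P * A\<^sup>T + Q * B\<^sup>T) (P * 0\<^sub>m n 0 + Q * 0\<^sub>m k 0)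
          (?Z n * A\<^sup>T + ?Z k * B\<^sup>T) (?Z n * 0\<^sub>m n 0 + ?Z k * 0\<^sub>m k 0)"
    using A P by (intro mult_four_block_mat) auto
  then have VW': "four_block_mat (P * A\<^sup>T + Q * B\<^sup>T) (P * 0\<^sub>m n 0 + Q * 0\<^sub>m k 0)
          (?Z n * A\<^sup>T + ?Z k * B\<^sup>T) (?Z n * 0\<^sub>m n 0 + ?Z k * 0\<^sub>m k 0) = 1\<^sub>m N"
    using VW unfolding mat_of_cols_append_eq_four_block[OF A] mat_of_cols_append_eq_four_block[OF P] T[OF A]
    by simp
  show "P * A\<^sup>T + Q * B\<^sup>T = 1\<^sub>m N"
  proof (rule eq_matI)
    fix i j assume "i < dim_row (1\<^sub>m N)" "j < dim_col (1\<^sub>m N)"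
    then show "(P * A\<^sup>T + Q * B\<^sup>T) $$ (i, j) = 1\<^sub>m N $$ (i, j)"
      using arg_cong[OF VW', of "\<lambda>M. M $$ (i, j)"] A P by simp
  qed (use A P in auto)
qed

section \<open>The solution formula\<close>

theorem proposition1p2:
  fixes N n :: nat and T :: real
    and C G C\<^sub>1 V\<^sub>C V\<^sub>N P\<^sub>C V U U\<^sub>R U\<^sub>N B\<^sub>1\<^sub>1 :: "real mat"
    and RR NN :: "real vec set"
    and u x x' x\<^sub>R x\<^sub>N x\<^sub>1 x\<^sub>2 u\<^sub>t :: "real \<Rightarrow> real vec"
  assumes C: "C \<in> carrier_mat N N" "sym_pos_semidef_mat C"
    and G: "G \<in> carrier_mat N N" "pos_def_mat G"
    and n: "n = vec_space.rank N C"
    and V\<^sub>C: "V\<^sub>C \<in> carrier_mat N n" "V\<^sub>C\<^sup>T * V\<^sub>C = 1\<^sub>m n"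
      "vec_space.col_space N V\<^sub>C = {C *\<^sub>v z | z. z \<in> carrier_vec N}"
    and C\<^sub>1: "C\<^sub>1 \<in> carrier_mat n n" "diagonal_mat C\<^sub>1" "\<forall>i < n. 0 < C\<^sub>1 $$ (i, i)"
    and decomp: "C = V\<^sub>C * C\<^sub>1 * V\<^sub>C\<^sup>T"
    and P\<^sub>C: "P\<^sub>C = V\<^sub>C * V\<^sub>C\<^sup>T"
    and RR: "RR = {P\<^sub>C *\<^sub>v z | z. z \<in> carrier_vec N}"
    and NN: "NN = {z \<in> carrier_vec N. P\<^sub>C *\<^sub>v z = 0\<^sub>v N}"
    and V\<^sub>N: "V\<^sub>N \<in> carrier_mat N (N - n)" "cols_form_basis N V\<^sub>N NN"
    and V: "V = mat_of_cols N (cols V\<^sub>C @ cols V\<^sub>N)"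
    and U: "U = (mat_inv V)\<^sup>T" "U = mat_of_cols N (cols U\<^sub>R @ cols U\<^sub>N)"
      "U\<^sub>R \<in> carrier_mat N n" "U\<^sub>N \<in> carrier_mat N (N - n)"
    and u: "vec_continuous_on N {0..T} u"
    and x: "\<forall>t \<in> {0..T}. x t \<in> carrier_vec N"
      "\<forall>t \<in> {0..T}. vec_has_deriv N x (x' t) (at t within {0..T})"
    and ode: "\<forall>t \<in> {0..T}. C *\<^sub>v x' t + G *\<^sub>v x t = u t"
    and split_x: "\<forall>t \<in> {0..T}. x\<^sub>R t \<in> RR \<and> x\<^sub>N t \<in> NN \<and> x t = x\<^sub>R t + x\<^sub>N t"
    and coords: "\<forall>t \<in> {0..T}. x\<^sub>1 t \<in> carrier_vec n \<and> x\<^sub>2 t \<in> carrier_vec (N - n) \<and>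
      x t = V\<^sub>C *\<^sub>v x\<^sub>1 t + V\<^sub>N *\<^sub>v x\<^sub>2 t"
    and B\<^sub>1\<^sub>1: "B\<^sub>1\<^sub>1 = V\<^sub>C\<^sup>T * mat_inv G * C * V\<^sub>C"
    and u\<^sub>t: "\<forall>t \<in> {0..T}. u\<^sub>t t = (mat_inv B\<^sub>1\<^sub>1 * V\<^sub>C\<^sup>T * mat_inv G) *\<^sub>v u t"
  shows "invertible_mat G \<and> invertible_mat V \<and> invertible_mat B\<^sub>1\<^sub>1 \<and> invertible_mat (U\<^sub>N\<^sup>T * G * V\<^sub>N) \<and>
    (\<forall>t \<in> {0..T}.
      x\<^sub>R t = V\<^sub>C *\<^sub>v x\<^sub>1 t \<and>
      V\<^sub>C *\<^sub>v x\<^sub>1 t = V\<^sub>C *\<^sub>v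
        (mat_exp ((- t) \<cdot>\<^sub>m mat_inv B\<^sub>1\<^sub>1) *\<^sub>v (V\<^sub>C\<^sup>T *\<^sub>v x 0) +
         mat_exp ((- t) \<cdot>\<^sub>m mat_inv B\<^sub>1\<^sub>1) *\<^sub>v
           vec_integral n {0..t} (\<lambda>s. mat_exp (s \<cdot>\<^sub>m mat_inv B\<^sub>1\<^sub>1) *\<^sub>v u\<^sub>t s)) \<and>
      x\<^sub>N t = V\<^sub>N *\<^sub>v x\<^sub>2 t \<and>
      V\<^sub>N *\<^sub>v x\<^sub>2 t = V\<^sub>N *\<^sub>v
        (mat_inv (U\<^sub>N\<^sup>T * G * V\<^sub>N) *\<^sub>v (U\<^sub>N\<^sup>T *\<^sub>v (u t - (G * V\<^sub>C) *\<^sub>v x\<^sub>1 t))))"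
proof -
  \<comment> \<open>Without this bound the truncated difference \<open>N - n\<close> would not complement \<open>n\<close>.\<close>
  have "n \<le> N"
    using vec_space.rank_le_nc[OF C(1)] n by simp
  define k where "k = N - n"
  have Nk: "N = n + k" and k: "N - n = k" using \<open>n \<le> N\<close> by (auto simp: k_def)
  note V\<^sub>N' = V\<^sub>N(1)[unfolded k] and U\<^sub>N' = U(4)[unfolded k]
  let ?K = "mat_inv G" and ?H = "U\<^sub>N\<^sup>T * G * V\<^sub>N" and ?A = "mat_inv B\<^sub>1\<^sub>1"
  have VCT: "V\<^sub>C\<^sup>T \<in> carrier_mat n N" using V\<^sub>C(1) by simp
  have UNT: "U\<^sub>N\<^sup>T \<in> carrier_mat k N" using U\<^sub>N' by simp
  have VNT: "V\<^sub>N\<^sup>T \<in> carrier_mat k N" using V\<^sub>N' by simp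
  have VC_left: "V\<^sub>C\<^sup>T *\<^sub>v (V\<^sub>C *\<^sub>v v) = v" if "v \<in> carrier_vec n" for v
    using assoc_mult_mat_vec[OF VCT V\<^sub>C(1) that] V\<^sub>C(2) that by simp
  have P: "P\<^sub>C \<in> carrier_mat N N" using V\<^sub>C(1) by (simp add: P\<^sub>C)
  have P_app: "P\<^sub>C *\<^sub>v z = V\<^sub>C *\<^sub>v (V\<^sub>C\<^sup>T *\<^sub>v z)" if "z \<in> carrier_vec N" for z
    unfolding P\<^sub>C by (rule assoc_mult_mat_vec[OF V\<^sub>C(1) VCT that])
  have VCT_N: "V\<^sub>C\<^sup>T *\<^sub>v z = 0\<^sub>v n" if "z \<in> NN" for z
  proof -
    have z: "z \<in> carrier_vec N" and "V\<^sub>C *\<^sub>v (V\<^sub>C\<^sup>T *\<^sub>v z) = 0\<^sub>v N"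
      using that P_app by (auto simp: NN)
    then show ?thesis
      using VC_left[OF mult_mat_vec_carrier[OF VCT z]] mult_mat_zero_vec[OF VCT] by simp
  qed
  have NN_sub: "submodule class_ring NN (module_vec TYPE(real) N)"
    unfolding NN by (rule submodule_null_space[OF P])
  have colsN: "set (cols V\<^sub>N) \<subseteq> NN"
    by (rule cols_form_basis_trivial_kernel(2)[OF V\<^sub>N' V\<^sub>N(2) NN_sub zero_carrier_vec mult_mat_zero_vec[OF V\<^sub>N']])
  have VCVN: "V\<^sub>C\<^sup>T * V\<^sub>N = 0\<^sub>m n k"
  proof (rule eq_matI)
    fix i j assume ij: "i < dim_row (0\<^sub>m n k)" "j < dim_col (0\<^sub>m n k)"
    then have "col V\<^sub>N j \<in> NN"
      using colsN V\<^sub>N' by (auto simp: cols_def)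
    then have "(V\<^sub>C\<^sup>T *\<^sub>v col V\<^sub>N j) $ i = 0"
      using VCT_N ij by simp
    then show "(V\<^sub>C\<^sup>T * V\<^sub>N) $$ (i, j) = 0\<^sub>m n k $$ (i, j)"
      using ij V\<^sub>C(1) V\<^sub>N' by simp
  qed (use V\<^sub>C(1) V\<^sub>N' in auto)
  have VCVN_app: "V\<^sub>C\<^sup>T *\<^sub>v (V\<^sub>N *\<^sub>v v) = 0\<^sub>v n" if "v \<in> carrier_vec k" for v
    using assoc_mult_mat_vec[OF VCT V\<^sub>N' that] VCVN that by (simp add: zero_mult_mat_vec)

  have V_car: "V \<in> carrier_mat N N"
    using mat_of_cols_carrier(1)[of N "cols V\<^sub>C @ cols V\<^sub>N"] V\<^sub>C(1) V\<^sub>N' Nk by (simp add: V)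
  \<comment> \<open>\<open>V\<^sub>C\<^sup>T\<close> isolates the first block of coordinates; independence of the columns of \<open>V\<^sub>N\<close> kills the second.\<close>
  have kerV: "v = 0\<^sub>v N" if v: "v \<in> carrier_vec N" "V *\<^sub>v v = 0\<^sub>v N" for v
  proof -
    define a b where "a = vec_first v n" and "b = vec_last v k"
    have ab: "a \<in> carrier_vec n" "b \<in> carrier_vec k" "v = a @\<^sub>v b"
      using v(1) Nk by (auto simp: a_def b_def vec_first_last_append)
    have sum0: "V\<^sub>C *\<^sub>v a + V\<^sub>N *\<^sub>v b = 0\<^sub>v N"
      using v(2) mat_of_cols_append_mult_append_vec[OF V\<^sub>C(1) V\<^sub>N' ab(1,2)] by (simp add: V ab(3))
    have Va: "V\<^sub>C *\<^sub>v a \<in> carrier_vec N" and Vb: "V\<^sub>N *\<^sub>v b \<in> carrier_vec N"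
      using V\<^sub>C(1) V\<^sub>N' ab by (meson mult_mat_vec_carrier)+
    have "a = V\<^sub>C\<^sup>T *\<^sub>v (V\<^sub>C *\<^sub>v a + V\<^sub>N *\<^sub>v b)"
      using mult_add_distrib_mat_vec[OF VCT Va Vb] VC_left[OF ab(1)] VCVN_app[OF ab(2)] ab(1) by simp
    then have a0: "a = 0\<^sub>v n"
      using sum0 mult_mat_zero_vec[OF VCT] by simp
    then have "V\<^sub>N *\<^sub>v b = 0\<^sub>v N"
      using sum0 Vb mult_mat_zero_vec[OF V\<^sub>C(1)] by simp
    then have "b = 0\<^sub>v k"
      by (rule cols_form_basis_trivial_kernel(1)[OF V\<^sub>N' V\<^sub>N(2) NN_sub ab(2)])
    then show ?thesis
      using a0 ab(3) Nk by auto
  qed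
  note invV = inverse_of_trivial_kernel[OF V_car kerV]
  have "U\<^sup>T * V = 1\<^sub>m N" using invV(4) by (simp add: U(1))
  moreover have "U * V\<^sup>T = 1\<^sub>m N"
    using transpose_mult[OF V_car invV(2)] invV(3) by (simp add: U(1))
  ultimately have blocks: "U\<^sub>N\<^sup>T * V\<^sub>C = 0\<^sub>m k n" "U\<^sub>N\<^sup>T * V\<^sub>N = 1\<^sub>m k" "U\<^sub>R * V\<^sub>C\<^sup>T + U\<^sub>N * V\<^sub>N\<^sup>T = 1\<^sub>m N"
    using dual_basis_blocks[OF V\<^sub>C(1) V\<^sub>N' U(3) U\<^sub>N'] by (simp_all add: V U(2) Nk[symmetric])

  have kerG: "v = 0\<^sub>v N" if "v \<in> carrier_vec N" "G *\<^sub>v v = 0\<^sub>v N" for v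
    using pos_def_mat_trivial_kernel[OF G(2,1) that(1)] that by simp
  note invG = inverse_of_trivial_kernel[OF G(1) kerG]
  have G_K: "G *\<^sub>v (?K *\<^sub>v v) = v" if "v \<in> carrier_vec N" for v
    using assoc_mult_mat_vec[OF G(1) invG(2) that] invG(3) that by simp
  have K_G: "?K *\<^sub>v (G *\<^sub>v v) = v" if "v \<in> carrier_vec N" for v
    using assoc_mult_mat_vec[OF invG(2) G(1) that] invG(4) that by simp

  \<comment> \<open>The vector \<open>w = V\<^sub>N z\<close> is orthogonal to the range of \<open>V\<^sub>C\<close>, so \<open>w = U\<^sub>N (V\<^sub>N\<^sup>T w)\<close>. If \<open>U\<^sub>N\<^sup>T G w = 0\<close>,
    this makes \<open>w\<close> orthogonal to \<open>G w\<close>.\<close>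
  have kerH: "z = 0\<^sub>v k" if z: "z \<in> carrier_vec k" "?H *\<^sub>v z = 0\<^sub>v k" for z
  proof -
    let ?w = "V\<^sub>N *\<^sub>v z"
    have w: "?w \<in> carrier_vec N" using V\<^sub>N' z(1) by (rule mult_mat_vec_carrier)
    have Gw: "G *\<^sub>v ?w \<in> carrier_vec N" using G(1) w by (rule mult_mat_vec_carrier)
    have VNw: "V\<^sub>N\<^sup>T *\<^sub>v ?w \<in> carrier_vec k" using VNT w by (rule mult_mat_vec_carrier)
    have "?w = (U\<^sub>R * V\<^sub>C\<^sup>T + U\<^sub>N * V\<^sub>N\<^sup>T) *\<^sub>v ?w"
      using w blocks(3) by simp
    also have "\<dots> = U\<^sub>R *\<^sub>v (V\<^sub>C\<^sup>T *\<^sub>v ?w) + U\<^sub>N *\<^sub>v (V\<^sub>N\<^sup>T *\<^sub>v ?w)"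
      using add_mult_distrib_mat_vec[OF mult_carrier_mat[OF U(3) VCT] mult_carrier_mat[OF U\<^sub>N' VNT] w]
        assoc_mult_mat_vec[OF U(3) VCT w] assoc_mult_mat_vec[OF U\<^sub>N' VNT w] by simp
    also have "\<dots> = U\<^sub>N *\<^sub>v (V\<^sub>N\<^sup>T *\<^sub>v ?w)"
      using VCVN_app[OF z(1)] mult_mat_zero_vec[OF U(3)] mult_mat_vec_carrier[OF U\<^sub>N' VNw] by simp
    finally have w_eq: "?w = U\<^sub>N *\<^sub>v (V\<^sub>N\<^sup>T *\<^sub>v ?w)" .
    have Hz: "U\<^sub>N\<^sup>T *\<^sub>v (G *\<^sub>v ?w) = 0\<^sub>v k"
      using z(2) assoc_mult_mat_vec[OF mult_carrier_mat[OF UNT G(1)] V\<^sub>N' z(1)]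
        assoc_mult_mat_vec[OF UNT G(1) w] by simp
    have "(G *\<^sub>v ?w) \<bullet> ?w = (G *\<^sub>v ?w) \<bullet> (U\<^sub>N *\<^sub>v (V\<^sub>N\<^sup>T *\<^sub>v ?w))"
      using w_eq by simp
    also have "\<dots> = (U\<^sub>N\<^sup>T *\<^sub>v (G *\<^sub>v ?w)) \<bullet> (V\<^sub>N\<^sup>T *\<^sub>v ?w)"
      by (rule transpose_vec_mult_scalar[OF U\<^sub>N' VNw Gw, symmetric])
    also have "\<dots> = 0" using Hz VNw by simp
    finally have "?w \<bullet> (G *\<^sub>v ?w) = 0"
      using comm_scalar_prod[OF w Gw] by simp
    then have "?w = 0\<^sub>v N"
      by (rule pos_def_mat_trivial_kernel[OF G(2,1) w])
    then show ?thesis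
      by (rule cols_form_basis_trivial_kernel(1)[OF V\<^sub>N' V\<^sub>N(2) NN_sub z(1)])
  qed
  have H: "?H \<in> carrier_mat k k" by (rule mult_carrier_mat[OF mult_carrier_mat[OF UNT G(1)] V\<^sub>N'])
  note invH = inverse_of_trivial_kernel[OF H kerH]

  have C_app: "C *\<^sub>v z = V\<^sub>C *\<^sub>v (C\<^sub>1 *\<^sub>v (V\<^sub>C\<^sup>T *\<^sub>v z))" if "z \<in> carrier_vec N" for z
    using assoc_mult_mat_vec[OF mult_carrier_mat[OF V\<^sub>C(1) C\<^sub>1(1)] VCT that]
      assoc_mult_mat_vec[OF V\<^sub>C(1) C\<^sub>1(1) mult_mat_vec_carrier[OF VCT that]] decomp by simp
  have B: "B\<^sub>1\<^sub>1 \<in> carrier_mat n n"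
    unfolding B\<^sub>1\<^sub>1 by (rule mult_carrier_mat[OF mult_carrier_mat[OF mult_carrier_mat[OF VCT invG(2)] C(1)] V\<^sub>C(1)])
  have B_app: "B\<^sub>1\<^sub>1 *\<^sub>v v = V\<^sub>C\<^sup>T *\<^sub>v (?K *\<^sub>v (V\<^sub>C *\<^sub>v (C\<^sub>1 *\<^sub>v v)))" if v: "v \<in> carrier_vec n" for v
  proof -
    have Vv: "V\<^sub>C *\<^sub>v v \<in> carrier_vec N" using V\<^sub>C(1) v by (rule mult_mat_vec_carrier)
    have CVv: "C *\<^sub>v (V\<^sub>C *\<^sub>v v) \<in> carrier_vec N" using C(1) Vv by (rule mult_mat_vec_carrier)
    have VK: "V\<^sub>C\<^sup>T * ?K \<in> carrier_mat n N" using VCT invG(2) by (rule mult_carrier_mat)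
    have "B\<^sub>1\<^sub>1 *\<^sub>v v = V\<^sub>C\<^sup>T *\<^sub>v (?K *\<^sub>v (C *\<^sub>v (V\<^sub>C *\<^sub>v v)))"
      unfolding B\<^sub>1\<^sub>1
      by (rule trans[OF assoc_mult_mat_vec[OF mult_carrier_mat[OF VK C(1)] V\<^sub>C(1) v]
            trans[OF assoc_mult_mat_vec[OF VK C(1) Vv] assoc_mult_mat_vec[OF VCT invG(2) CVv]]])
    then show ?thesis using C_app[OF Vv] VC_left[OF v] by simp
  qed
  \<comment> \<open>With \<open>q = G\<^sup>-\<^sup>1 V\<^sub>C C\<^sub>1 v\<close> one has \<open>q \<bullet> G q = (V\<^sub>C\<^sup>T q) \<bullet> C\<^sub>1 v = (B\<^sub>1\<^sub>1 v) \<bullet> C\<^sub>1 v\<close>.\<close>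
  have kerB: "v = 0\<^sub>v n" if v: "v \<in> carrier_vec n" "B\<^sub>1\<^sub>1 *\<^sub>v v = 0\<^sub>v n" for v
  proof -
    let ?d = "C\<^sub>1 *\<^sub>v v"
    let ?q = "?K *\<^sub>v (V\<^sub>C *\<^sub>v ?d)"
    have d: "?d \<in> carrier_vec n" using C\<^sub>1(1) v(1) by (rule mult_mat_vec_carrier)
    have Vd: "V\<^sub>C *\<^sub>v ?d \<in> carrier_vec N" using V\<^sub>C(1) d by (rule mult_mat_vec_carrier)
    have q: "?q \<in> carrier_vec N" using invG(2) Vd by (rule mult_mat_vec_carrier)
    have "?q \<bullet> (G *\<^sub>v ?q) = ?q \<bullet> (V\<^sub>C *\<^sub>v ?d)"
      using G_K[OF Vd] by simp
    also have "\<dots> = (V\<^sub>C\<^sup>T *\<^sub>v ?q) \<bullet> ?d"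
      by (rule transpose_vec_mult_scalar[OF V\<^sub>C(1) d q, symmetric])
    also have "\<dots> = 0" unfolding B_app[OF v(1), symmetric] v(2) using d by simp
    finally have "?q = 0\<^sub>v N"
      by (rule pos_def_mat_trivial_kernel[OF G(2,1) q])
    then have "V\<^sub>C *\<^sub>v ?d = 0\<^sub>v N"
      using G_K[OF Vd] mult_mat_zero_vec[OF G(1)] by simp
    then have "?d = 0\<^sub>v n"
      using VC_left[OF d] mult_mat_zero_vec[OF VCT] by simp
    then show ?thesis
      by (rule pos_diagonal_mat_trivial_kernel[OF C\<^sub>1 v(1)])
  qed
  note invB = inverse_of_trivial_kernel[OF B kerB]
  have A_B: "?A *\<^sub>v (B\<^sub>1\<^sub>1 *\<^sub>v v) = v" if "v \<in> carrier_vec n" for v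
    using assoc_mult_mat_vec[OF invB(2) B that] invB(4) that by simp

  have u_car: "u s \<in> carrier_vec N" if "s \<in> {0..T}" for s
    using u that by (auto simp: vec_continuous_on_def)
  have x_car: "x s \<in> carrier_vec N" "x' s \<in> carrier_vec N" if "s \<in> {0..T}" for s
    using x that by (auto simp: vec_has_deriv_def)
  have x12: "x\<^sub>1 s \<in> carrier_vec n" "x\<^sub>2 s \<in> carrier_vec k" "x s = V\<^sub>C *\<^sub>v x\<^sub>1 s + V\<^sub>N *\<^sub>v x\<^sub>2 s"
    "V\<^sub>C *\<^sub>v x\<^sub>1 s \<in> carrier_vec N" "V\<^sub>N *\<^sub>v x\<^sub>2 s \<in> carrier_vec N"
    if "s \<in> {0..T}" for s
    using coords that mult_mat_vec_carrier[OF V\<^sub>C(1)] mult_mat_vec_carrier[OF V\<^sub>N'] by (auto simp: k)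
  have x1: "V\<^sub>C\<^sup>T *\<^sub>v x s = x\<^sub>1 s" if s: "s \<in> {0..T}" for s
    using mult_add_distrib_mat_vec[OF VCT x12(4,5)[OF s]] x12(1,3)[OF s]
      VC_left[OF x12(1)[OF s]] VCVN_app[OF x12(2)[OF s]] by simp
  have deriv: "vec_has_deriv n (\<lambda>s. V\<^sub>C\<^sup>T *\<^sub>v x s) (V\<^sub>C\<^sup>T *\<^sub>v x' s) (at s within {0..T})"
    if s: "s \<in> {0..T}" for s
  proof -
    have "vec_has_deriv n (\<lambda>s. V\<^sub>C\<^sup>T *\<^sub>v x s) (0\<^sub>m n N *\<^sub>v x s + V\<^sub>C\<^sup>T *\<^sub>v x' s) (at s within {0..T})"
      by (rule mult_mat_vec_has_deriv) (use VCT x s in auto)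
    moreover have "0\<^sub>m n N *\<^sub>v x s + V\<^sub>C\<^sup>T *\<^sub>v x' s = V\<^sub>C\<^sup>T *\<^sub>v x' s"
      using x_car[OF s] mult_mat_vec_carrier[OF VCT x_car(2)[OF s]] by (simp add: zero_mult_mat_vec)
    ultimately show ?thesis by simp
  qed
  \<comment> \<open>Multiplying the equation by \<open>V\<^sub>C\<^sup>T G\<^sup>-\<^sup>1\<close> gives \<open>B\<^sub>1\<^sub>1 y' + y = V\<^sub>C\<^sup>T G\<^sup>-\<^sup>1 u\<close> for \<open>y = V\<^sub>C\<^sup>T x\<close>.\<close>
  have ut_car: "u\<^sub>t s \<in> carrier_vec n" and
    x1': "V\<^sub>C\<^sup>T *\<^sub>v x' s = u\<^sub>t s - ?A *\<^sub>v (V\<^sub>C\<^sup>T *\<^sub>v x s)" if s: "s \<in> {0..T}" for s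
  proof -
    let ?y' = "V\<^sub>C\<^sup>T *\<^sub>v x' s" and ?y = "V\<^sub>C\<^sup>T *\<^sub>v x s"
    have y: "?y \<in> carrier_vec n" "?y' \<in> carrier_vec n"
      using mult_mat_vec_carrier[OF VCT] x_car[OF s] by auto
    have Cx': "C *\<^sub>v x' s \<in> carrier_vec N" and Gx: "G *\<^sub>v x s \<in> carrier_vec N"
      using mult_mat_vec_carrier C(1) G(1) x_car[OF s] by blast+
    have Ku: "?K *\<^sub>v u s \<in> carrier_vec N"
      using invG(2) u_car[OF s] by (rule mult_mat_vec_carrier)
    have KCx: "?K *\<^sub>v (C *\<^sub>v x' s) \<in> carrier_vec N"
      using invG(2) Cx' by (rule mult_mat_vec_carrier)
    have "?K *\<^sub>v u s = ?K *\<^sub>v (C *\<^sub>v x' s) + x s"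
      using mult_add_distrib_mat_vec[OF invG(2) Cx' Gx] ode s K_G[OF x_car(1)[OF s]] by simp
    then have VKu: "V\<^sub>C\<^sup>T *\<^sub>v (?K *\<^sub>v u s) = B\<^sub>1\<^sub>1 *\<^sub>v ?y' + ?y"
      using mult_add_distrib_mat_vec[OF VCT KCx x_car(1)[OF s]] B_app[OF y(2)] C_app[OF x_car(2)[OF s]]
      by simp
    have "u\<^sub>t s = (?A * V\<^sub>C\<^sup>T * ?K) *\<^sub>v u s"
      using u\<^sub>t s by blast
    also have "\<dots> = ?A *\<^sub>v (V\<^sub>C\<^sup>T *\<^sub>v (?K *\<^sub>v u s))"
      by (rule trans[OF assoc_mult_mat_vec[OF mult_carrier_mat[OF invB(2) VCT] invG(2) u_car[OF s]]
            assoc_mult_mat_vec[OF invB(2) VCT Ku]])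
    also have "\<dots> = ?A *\<^sub>v (B\<^sub>1\<^sub>1 *\<^sub>v ?y' + ?y)"
      by (simp only: VKu)
    also have "\<dots> = ?A *\<^sub>v (B\<^sub>1\<^sub>1 *\<^sub>v ?y') + ?A *\<^sub>v ?y"
      by (rule mult_add_distrib_mat_vec[OF invB(2) mult_mat_vec_carrier[OF B y(2)] y(1)])
    also have "?A *\<^sub>v (B\<^sub>1\<^sub>1 *\<^sub>v ?y') = ?y'"
      by (rule A_B[OF y(2)])
    finally have ut: "u\<^sub>t s = ?y' + ?A *\<^sub>v ?y" .
    have Ay: "?A *\<^sub>v ?y \<in> carrier_vec n"
      using invB(2) y(1) by (rule mult_mat_vec_carrier)
    show "u\<^sub>t s \<in> carrier_vec n" using ut y(2) Ay by simp
    show "?y' = u\<^sub>t s - ?A *\<^sub>v ?y"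
      unfolding ut by (rule add_diff_cancel_right_vec[OF y(2) Ay, symmetric])
  qed

  have main: "x\<^sub>R t = V\<^sub>C *\<^sub>v x\<^sub>1 t \<and>
      V\<^sub>C *\<^sub>v x\<^sub>1 t = V\<^sub>C *\<^sub>v
        (mat_exp ((- t) \<cdot>\<^sub>m ?A) *\<^sub>v (V\<^sub>C\<^sup>T *\<^sub>v x 0) +
         mat_exp ((- t) \<cdot>\<^sub>m ?A) *\<^sub>v vec_integral n {0..t} (\<lambda>s. mat_exp (s \<cdot>\<^sub>m ?A) *\<^sub>v u\<^sub>t s)) \<and>
      x\<^sub>N t = V\<^sub>N *\<^sub>v x\<^sub>2 t \<and>
      V\<^sub>N *\<^sub>v x\<^sub>2 t = V\<^sub>N *\<^sub>v (mat_inv ?H *\<^sub>v (U\<^sub>N\<^sup>T *\<^sub>v (u t - (G * V\<^sub>C) *\<^sub>v x\<^sub>1 t)))"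
    if t: "t \<in> {0..T}" for t
  proof (intro conjI)
    note x12t = x12[OF t]
    have "V\<^sub>C\<^sup>T *\<^sub>v x t = mat_exp ((- t) \<cdot>\<^sub>m ?A) *\<^sub>v (V\<^sub>C\<^sup>T *\<^sub>v x 0) +
        mat_exp ((- t) \<cdot>\<^sub>m ?A) *\<^sub>v vec_integral n {0..t} (\<lambda>s. mat_exp (s \<cdot>\<^sub>m ?A) *\<^sub>v u\<^sub>t s)"
    proof (rule variation_of_constants[OF invB(2) _ ut_car _ t])
      fix s assume s: "s \<in> {0..T}"
      show "V\<^sub>C\<^sup>T *\<^sub>v x s \<in> carrier_vec n"
        using VCT x_car(1)[OF s] by (rule mult_mat_vec_carrier)
      show "vec_has_deriv n (\<lambda>s. V\<^sub>C\<^sup>T *\<^sub>v x s) (u\<^sub>t s - ?A *\<^sub>v (V\<^sub>C\<^sup>T *\<^sub>v x s)) (at s within {0..T})"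
        using deriv[OF s] x1'[OF s] by simp
    qed
    then show "V\<^sub>C *\<^sub>v x\<^sub>1 t = V\<^sub>C *\<^sub>v
        (mat_exp ((- t) \<cdot>\<^sub>m ?A) *\<^sub>v (V\<^sub>C\<^sup>T *\<^sub>v x 0) +
         mat_exp ((- t) \<cdot>\<^sub>m ?A) *\<^sub>v vec_integral n {0..t} (\<lambda>s. mat_exp (s \<cdot>\<^sub>m ?A) *\<^sub>v u\<^sub>t s))"
      using x1[OF t] by simp
    have split: "x\<^sub>R t \<in> RR" "x\<^sub>N t \<in> NN" "x t = x\<^sub>R t + x\<^sub>N t"
      using split_x t by auto
    then have xN: "x\<^sub>N t \<in> carrier_vec N" by (simp add: NN)
    obtain z where z: "z \<in> carrier_vec N" "x\<^sub>R t = V\<^sub>C *\<^sub>v (V\<^sub>C\<^sup>T *\<^sub>v z)"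
      using split(1) P_app unfolding RR by auto
    have yz: "V\<^sub>C\<^sup>T *\<^sub>v z \<in> carrier_vec n" using VCT z(1) by (rule mult_mat_vec_carrier)
    have xR: "x\<^sub>R t \<in> carrier_vec N"
      unfolding z(2) using V\<^sub>C(1) yz by (rule mult_mat_vec_carrier)
  \<comment> \<open>Applying \<open>V\<^sub>C\<^sup>T\<close> to both decompositions of \<open>x t\<close> identifies their range components.\<close>
    have "V\<^sub>C\<^sup>T *\<^sub>v x t = V\<^sub>C\<^sup>T *\<^sub>v z"
      using mult_add_distrib_mat_vec[OF VCT xR xN] VCT_N[OF split(2)] VC_left[OF yz] yz
      by (simp add: split(3) z(2))
    then show R: "x\<^sub>R t = V\<^sub>C *\<^sub>v x\<^sub>1 t"
      using x1[OF t] z(2) by simp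
    show "x\<^sub>N t = V\<^sub>N *\<^sub>v x\<^sub>2 t"
    proof -
      have "x\<^sub>N t + V\<^sub>C *\<^sub>v x\<^sub>1 t = V\<^sub>N *\<^sub>v x\<^sub>2 t + V\<^sub>C *\<^sub>v x\<^sub>1 t"
        using split(3) R x12t(3) comm_add_vec[OF xN x12t(4)] comm_add_vec[OF x12t(5,4)] by metis
      then show ?thesis
        using add_diff_cancel_right_vec[OF xN x12t(4)] add_diff_cancel_right_vec[OF x12t(5,4)] by metis
    qed
  \<comment> \<open>The range of \<open>C\<close> lies in that of \<open>V\<^sub>C\<close>, which \<open>U\<^sub>N\<^sup>T\<close> annihilates.\<close>
    have CU: "U\<^sub>N\<^sup>T *\<^sub>v (C *\<^sub>v x' t) = 0\<^sub>v k"
    proof -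
      have c: "C\<^sub>1 *\<^sub>v (V\<^sub>C\<^sup>T *\<^sub>v x' t) \<in> carrier_vec n"
        using mult_mat_vec_carrier[OF C\<^sub>1(1) mult_mat_vec_carrier[OF VCT x_car(2)[OF t]]] .
      show ?thesis
        using C_app[OF x_car(2)[OF t]] assoc_mult_mat_vec[OF UNT V\<^sub>C(1) c] blocks(1) c
        by (simp add: zero_mult_mat_vec)
    qed
    have GV: "(G * V\<^sub>C) *\<^sub>v x\<^sub>1 t = G *\<^sub>v (V\<^sub>C *\<^sub>v x\<^sub>1 t)"
      by (rule assoc_mult_mat_vec[OF G(1) V\<^sub>C(1) x12t(1)])
    have car: "C *\<^sub>v x' t \<in> carrier_vec N" "G *\<^sub>v (V\<^sub>C *\<^sub>v x\<^sub>1 t) \<in> carrier_vec N"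
      "G *\<^sub>v (V\<^sub>N *\<^sub>v x\<^sub>2 t) \<in> carrier_vec N"
      using mult_mat_vec_carrier C(1) G(1) x_car[OF t] x12t(4,5) by blast+
    have "u t = C *\<^sub>v x' t + (G *\<^sub>v (V\<^sub>N *\<^sub>v x\<^sub>2 t) + G *\<^sub>v (V\<^sub>C *\<^sub>v x\<^sub>1 t))"
      using ode t mult_add_distrib_mat_vec[OF G(1) x12t(4,5)] x12t(3) comm_add_vec[OF car(2,3)] by metis
    also have "\<dots> = (C *\<^sub>v x' t + G *\<^sub>v (V\<^sub>N *\<^sub>v x\<^sub>2 t)) + G *\<^sub>v (V\<^sub>C *\<^sub>v x\<^sub>1 t)"
      by (rule assoc_add_vec[OF car(1,3,2), symmetric])
    finally have "u t - (G * V\<^sub>C) *\<^sub>v x\<^sub>1 t = C *\<^sub>v x' t + G *\<^sub>v (V\<^sub>N *\<^sub>v x\<^sub>2 t)"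
      using add_diff_cancel_right_vec[OF add_carrier_vec[OF car(1,3)] car(2)] GV by metis
    then have "U\<^sub>N\<^sup>T *\<^sub>v (u t - (G * V\<^sub>C) *\<^sub>v x\<^sub>1 t) = ?H *\<^sub>v x\<^sub>2 t"
      using mult_add_distrib_mat_vec[OF UNT car(1,3)] CU mult_mat_vec_carrier[OF UNT car(3)]
        assoc_mult_mat_vec[OF mult_carrier_mat[OF UNT G(1)] V\<^sub>N' x12t(2)]
        assoc_mult_mat_vec[OF UNT G(1) x12t(5)] by simp
    then have "mat_inv ?H *\<^sub>v (U\<^sub>N\<^sup>T *\<^sub>v (u t - (G * V\<^sub>C) *\<^sub>v x\<^sub>1 t)) = x\<^sub>2 t"
      using assoc_mult_mat_vec[OF invH(2) H x12t(2)] invH(4) x12t(2) by simp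
    then show "V\<^sub>N *\<^sub>v x\<^sub>2 t = V\<^sub>N *\<^sub>v (mat_inv ?H *\<^sub>v (U\<^sub>N\<^sup>T *\<^sub>v (u t - (G * V\<^sub>C) *\<^sub>v x\<^sub>1 t)))"
      by simp
  qed
  show ?thesis
    using invG(1) invV(1) invB(1) invH(1) main by blast
qed

end
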